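(* Every latin square $L$ of order $n\ge1$ contains at least $3n^4+n^3-9n^2+6n$ cuboctahedra.
   Context: A latin square of order $n$ is an $n\times n$ array $L=(q_{x,y})$, $x,y\in\{0,\ldots,n-1\}$, filled with symbols from $\{0,\ldots,n-1\}$ so that every row and every column contains each symbol exactly once. A cuboctahedron in $L$ is a tuple of ordered pairs $(a^1_1,a^1_2),(a^2_1,a^2_2),(b^1_1,b^1_2),(b^2_1,b^2_2)$ of elements of $\{0,\ldots,n-1\}$ such that $q_{a^1_{j_1},a^2_{j_2}}=q_{b^1_{j_1},b^2_{j_2}}$ for all $j_1,j_2\in\{1,2\}$; cuboctahedra are counted as such tuples. *)

theory Defs
  imports Main
begin

text \<open>Only the values \<open>L x y\<close> with \<open>x < n\<close> and \<open>y < n\<close> matter: rows, columns and symbols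
  are all indexed by \<open>{..<n}\<close>.\<close>

definition latin_square :: "nat \<Rightarrow> (nat \<Rightarrow> nat \<Rightarrow> nat) \<Rightarrow> bool" where
  "latin_square n L \<longleftrightarrow>
     (\<forall>x<n. \<forall>y<n. L x y < n) \<and>
     (\<forall>x<n. \<forall>s<n. \<exists>!y. y < n \<and> L x y = s) \<and>
     (\<forall>y<n. \<forall>s<n. \<exists>!x. x < n \<and> L x y = s)"

text \<open>The projections \<open>\<pi>\<close> and \<open>\<rho>\<close> play the role of the indices $j_1, j_2 \in \{1,2\}$
  selecting a component of an ordered pair. Repeated entries are allowed, and the
  tuples are ordered.\<close>

definition cuboctahedra ::
  "nat \<Rightarrow> (nat \<Rightarrow> nat \<Rightarrow> nat) \<Rightarrow>
    ((nat \<times> nat) \<times> (nat \<times> nat) \<times> (nat \<times> nat) \<times> (nat \<times> nat)) set" where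
  "cuboctahedra n L =
     {(a1, a2, b1, b2).
        a1 \<in> {..<n} \<times> {..<n} \<and> a2 \<in> {..<n} \<times> {..<n} \<and>
        b1 \<in> {..<n} \<times> {..<n} \<and> b2 \<in> {..<n} \<times> {..<n} \<and>
        (\<forall>\<pi>\<in>{fst, snd}. \<forall>\<rho>\<in>{fst, snd}. L (\<pi> a1) (\<rho> a2) = L (\<pi> b1) (\<rho> b2))}"

end

theory Submission
  imports Defs
begin

text \<open>For rows \<open>a, b, c, d\<close> let \<open>f a b c d\<close> be the number of pairs of columns \<open>(x, y)\<close> with
  \<open>L a x = L b y\<close> and \<open>L c x = L d y\<close>. A cuboctahedron is a choice of four rows together with
  two such pairs, so the count is the sum of the squares \<open>(f a b c d)\<^sup>2\<close>. For fixed \<open>a, b, c\<close>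
  the numbers \<open>f a b c d\<close> add up to \<open>n\<close> over \<open>d\<close>. If \<open>a = b\<close> or \<open>a = c\<close>, they are concentrated
  on a single \<open>d\<close>, which contributes \<open>n\<^sup>2\<close>. Otherwise \<open>f a b c d\<close> vanishes for \<open>d \<in> {b, c}\<close>,
  so at most \<open>n - 2\<close> values (\<open>n - 1\<close> if \<open>b = c\<close>) are nonzero, and \<open>k\<^sup>2 \<ge> 3 k - 2\<close> for integers
  \<open>k\<close> gives a sum of squares of at least \<open>n + 4\<close> (respectively \<open>n + 2\<close>).\<close>

definition matches ::
  "nat \<Rightarrow> (nat \<Rightarrow> nat \<Rightarrow> nat) \<Rightarrow> nat \<Rightarrow> nat \<Rightarrow> nat \<Rightarrow> nat \<Rightarrow> (nat \<times> nat) set" where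
  "matches n L a b c d =
     {(x, y). x < n \<and> y < n \<and> L a x = L b y \<and> L c x = L d y}"

lemma finite_matches [simp]: "finite (matches n L a b c d)"
  by (rule finite_subset[of _ "{..<n} \<times> {..<n}"]) (auto simp: matches_def)

lemma card_cuboctahedra:
  "card (cuboctahedra n L) =
     (\<Sum>a<n. \<Sum>b<n. \<Sum>c<n. \<Sum>d<n. (card (matches n L a b c d))\<^sup>2)"
proof -
  define S where "S = (SIGMA a:{..<n}. SIGMA b:{..<n}. SIGMA c:{..<n}. SIGMA d:{..<n}.
    matches n L a b c d \<times> matches n L a b c d)"
  \<comment> \<open>The rows are \<open>(a, c)\<close> and \<open>(b, d)\<close>. The columns are
    regrouped by index: the first components of the two column pairs form the match
    \<open>(x, y)\<close>, the second components \<open>(x', y')\<close>.\<close>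
  have "bij_betw (\<lambda>(a, b, c, d, (x, y), (x', y')). ((a, c), (x, x'), (b, d), (y, y')))
      S (cuboctahedra n L)"
    by (rule bij_betw_byWitness[where
          f' = "\<lambda>((a, c), (x, x'), (b, d), (y, y')). (a, b, c, d, (x, y), (x', y'))"])
      (auto simp: S_def matches_def cuboctahedra_def)
  then have "card (cuboctahedra n L) = card S"
    by (simp add: bij_betw_same_card)
  also have "\<dots> = (\<Sum>a<n. \<Sum>b<n. \<Sum>c<n. \<Sum>d<n. (card (matches n L a b c d))\<^sup>2)"
    by (simp add: S_def card_cartesian_product power2_eq_square)
  finally show ?thesis .
qed

text \<open>No integer lies strictly between 1 and 2, so \<open>(k - 1) * (k - 2)\<close> is never
  negative. The bound is sharp exactly when all values are 1 or 2, which suits an average slightly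
  above 1.\<close>

lemma sum_squares_ge:
  fixes f :: "'a \<Rightarrow> int"
  shows "(\<Sum>x\<in>A. (f x)\<^sup>2) \<ge> 3 * (\<Sum>x\<in>A. f x) - 2 * int (card A)"
proof -
  have "k\<^sup>2 \<ge> 3 * k - 2" for k :: int
  proof -
    have "(k - 1) * (k - 2) \<ge> 0"
      by (cases "k \<le> 1") (auto intro: mult_nonpos_nonpos)
    then show ?thesis
      by (simp add: algebra_simps power2_eq_square)
  qed
  then have "(\<Sum>x\<in>A. 3 * f x - 2) \<le> (\<Sum>x\<in>A. (f x)\<^sup>2)"
    by (intro sum_mono)
  then show ?thesis
    by (simp add: sum_subtractf flip: sum_distrib_left)
qed

context
  fixes n :: nat and L :: "nat \<Rightarrow> nat \<Rightarrow> nat"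
  assumes latin: "latin_square n L"
begin

lemma symbol_less: "x < n \<Longrightarrow> y < n \<Longrightarrow> L x y < n"
  and ex1_column: "x < n \<Longrightarrow> s < n \<Longrightarrow> \<exists>!y. y < n \<and> L x y = s"
  and ex1_row: "y < n \<Longrightarrow> s < n \<Longrightarrow> \<exists>!x. x < n \<and> L x y = s"
  using latin unfolding latin_square_def by auto

lemma column_unique: "x < n \<Longrightarrow> y < n \<Longrightarrow> y' < n \<Longrightarrow> L x y = L x y' \<Longrightarrow> y = y'"
  using ex1_column[of x "L x y"] symbol_less by metis

lemma row_unique: "x < n \<Longrightarrow> x' < n \<Longrightarrow> y < n \<Longrightarrow> L x y = L x' y \<Longrightarrow> x = x'"
  using ex1_row[of y "L x y"] symbol_less by metis

text \<open>The symbol in row \<open>a\<close> and column \<open>x\<close> occurs in exactly one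
  column \<open>y\<close> of row \<open>b\<close>.\<close>

lemma card_equal_symbols:
  assumes "a < n" "b < n"
  shows "card {(x, y). x < n \<and> y < n \<and> L a x = L b y} = n"
proof -
  have "card {y. y < n \<and> L a x = L b y} = 1" if x: "x < n" for x
  proof -
    obtain y where "y < n" "L b y = L a x"
      using ex1_column[OF \<open>b < n\<close> symbol_less[OF \<open>a < n\<close> x]] by blast
    then have "{y. y < n \<and> L a x = L b y} = {y}"
      using column_unique[OF \<open>b < n\<close>] by auto
    then show ?thesis
      by simp
  qed
  then have "card (SIGMA x:{..<n}. {y. y < n \<and> L a x = L b y}) = n"
    by simp
  moreover have "(SIGMA x:{..<n}. {y. y < n \<and> L a x = L b y}) =
      {(x, y). x < n \<and> y < n \<and> L a x = L b y}"
    by auto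
  ultimately show ?thesis
    by simp
qed

text \<open>A pair \<open>(x, y)\<close> with \<open>L a x = L b y\<close> determines
  \<open>d\<close> as the only row with symbol \<open>L c x\<close> in column \<open>y\<close>, so
  the sets of matches partition these pairs.\<close>

lemma sum_card_matches:
  assumes "a < n" "b < n" "c < n"
  shows "(\<Sum>d<n. card (matches n L a b c d)) = n"
proof -
  have "(\<Sum>d<n. card (matches n L a b c d)) = card (\<Union>d<n. matches n L a b c d)"
  proof (rule card_UN_disjoint[symmetric])
    show "\<forall>d\<in>{..<n}. \<forall>d'\<in>{..<n}. d \<noteq> d' \<longrightarrow> matches n L a b c d \<inter> matches n L a b c d' = {}"
    proof (intro ballI impI equals0I)
      fix d d' p assume "d \<in> {..<n}" "d' \<in> {..<n}" "d \<noteq> d'"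
        and "p \<in> matches n L a b c d \<inter> matches n L a b c d'"
      then show False
        using row_unique[of d d' "snd p"] by (auto simp: matches_def)
    qed
  qed auto
  also have "(\<Union>d<n. matches n L a b c d) = {(x, y). x < n \<and> y < n \<and> L a x = L b y}"
  proof (intro equalityI subsetI)
    fix p assume "p \<in> {(x, y). x < n \<and> y < n \<and> L a x = L b y}"
    then obtain x y where p: "p = (x, y)" "x < n" "y < n" "L a x = L b y"
      by auto
    then obtain d where "d < n" "L c x = L d y"
      using ex1_row[OF _ symbol_less[OF \<open>c < n\<close>]] by metis
    then show "p \<in> (\<Union>d<n. matches n L a b c d)"
      using p by (auto simp: matches_def)
  qed (auto simp: matches_def)
  finally show ?thesis
    using card_equal_symbols assms by simp
qed

lemma card_matches_same_pair: "a < n \<Longrightarrow> b < n \<Longrightarrow> card (matches n L a b a b) = n"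
  using card_equal_symbols by (simp add: matches_def)

lemma card_matches_same_rows:
  assumes "a < n" "c < n"
  shows "card (matches n L a a c c) = n"
proof -
  have "matches n L a a c c = {(x, y). x < n \<and> y < n \<and> L a x = L a y}"
    using column_unique[OF \<open>a < n\<close>] by (auto simp: matches_def)
  then show ?thesis
    using card_equal_symbols assms by simp
qed

text \<open>A match would give \<open>L a x = L b y = L c x\<close>, repeating a symbol in column
  \<open>x\<close>.\<close>

lemma matches_repeated_target:
  assumes "a < n" "c < n" "a \<noteq> c"
  shows "matches n L a b c b = {}"
  using assms row_unique[of a c] by (fastforce simp: matches_def)

text \<open>Here \<open>L c x = L c y\<close> forces \<open>x = y\<close>, and then
  \<open>L a x = L b x\<close> repeats a symbol in column \<open>x\<close>.\<close>

lemma matches_fixed_row: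
  assumes "a < n" "b < n" "c < n" "a \<noteq> b"
  shows "matches n L a b c c = {}"
  using assms column_unique[of c] row_unique[of a b] by (auto simp: matches_def)

lemma sum_squares_matches_diag:
  assumes "a < n" "b < n" "c < n" "a = b \<or> a = c"
  shows "(\<Sum>d<n. (int (card (matches n L a b c d)))\<^sup>2) \<ge> (int n)\<^sup>2"
proof -
  \<comment> \<open>The row carrying all \<open>n\<close> matches: \<open>a = b\<close> makes
    \<open>d = c\<close> work, and \<open>a = c\<close> makes \<open>d = b\<close> work.\<close>
  define d where "d = (if a = b then c else b)"
  have "d < n" "card (matches n L a b c d) = n"
    using assms card_matches_same_pair card_matches_same_rows by (auto simp: d_def)
  then show ?thesis
    using member_le_sum[of d "{..<n}" "\<lambda>d. (int (card (matches n L a b c d)))\<^sup>2"] by simp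
qed

text \<open>Using \<open>card {b, c}\<close> treats \<open>b = c\<close> and
  \<open>b \<noteq> c\<close> together; the bound is
  \<open>3 * n - 2 * (n - card {b, c})\<close>.\<close>

lemma sum_squares_matches_offdiag:
  assumes "a < n" "b < n" "c < n" "a \<noteq> b" "a \<noteq> c"
  shows "(\<Sum>d<n. (int (card (matches n L a b c d)))\<^sup>2) \<ge> int n + 2 * int (card {b, c})"
proof -
  let ?f = "\<lambda>d. int (card (matches n L a b c d))" and ?D = "{..<n} - {b, c}"
  have zero: "?f d = 0" if "d \<in> {b, c}" for d
    using that matches_repeated_target matches_fixed_row assms by auto
  have "(\<Sum>d\<in>?D. ?f d) = (\<Sum>d<n. ?f d)" "(\<Sum>d\<in>?D. (?f d)\<^sup>2) = (\<Sum>d<n. (?f d)\<^sup>2)"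
    using zero by (intro sum.mono_neutral_left; force)+
  moreover have "(\<Sum>d<n. ?f d) = int n"
    using sum_card_matches[OF assms(1-3)] by (simp flip: of_nat_sum)
  moreover have "card {b, c} \<le> n" "card ?D = n - card {b, c}"
    using card_mono[of "{..<n}" "{b, c}"] assms by (auto simp: card_Diff_subset)
  ultimately show ?thesis
    using sum_squares_ge[of ?f ?D] by simp
qed

text \<open>If \<open>a = b\<close>, each \<open>c\<close> gives at least the square of
  \<open>n\<close>. Otherwise only \<open>c = a\<close> does, while \<open>c = b\<close> gives
  \<open>n + 2\<close> and each of the other \<open>n - 2\<close> rows gives
  \<open>n + 4\<close>.\<close>

lemma sum_squares_matches_two_rows:
  assumes "a < n" "b < n"
  shows "(\<Sum>c<n. \<Sum>d<n. (int (card (matches n L a b c d)))\<^sup>2) \<ge>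
    (if a = b then int n ^ 3 else 2 * (int n)\<^sup>2 + 3 * int n - 6)"
proof (cases "a = b")
  case True
  have "(\<Sum>c<n. (int n)\<^sup>2) \<le> (\<Sum>c<n. \<Sum>d<n. (int (card (matches n L a b c d)))\<^sup>2)"
    using sum_squares_matches_diag assms True by (intro sum_mono) auto
  then show ?thesis
    using True by (simp add: power2_eq_square power3_eq_cube)
next
  case False
  let ?g = "\<lambda>c. \<Sum>d<n. (int (card (matches n L a b c d)))\<^sup>2"
  have "(\<Sum>c\<in>{..<n} - {a, b}. int n + 4) \<le> (\<Sum>c\<in>{..<n} - {a, b}. ?g c)"
  proof (intro sum_mono)
    fix c assume "c \<in> {..<n} - {a, b}"
    then show "int n + 4 \<le> ?g c"
      using sum_squares_matches_offdiag[of a b c] assms False by auto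
  qed
  moreover have "card {a, b} = 2" "card {a, b} \<le> n"
    using card_mono[of "{..<n}" "{a, b}"] assms False by auto
  then have "int (card ({..<n} - {a, b})) = int n - 2"
    using assms by (simp add: card_Diff_subset)
  moreover have "?g a \<ge> (int n)\<^sup>2"
    using sum_squares_matches_diag assms by auto
  moreover have "?g b \<ge> int n + 2"
    using sum_squares_matches_offdiag[of a b b] assms False by auto
  moreover have "(\<Sum>c<n. ?g c) = (\<Sum>c\<in>{..<n} - {a, b}. ?g c) + (\<Sum>c\<in>{a, b}. ?g c)"
    using assms by (intro sum.subset_diff) auto
  ultimately have "(\<Sum>c<n. ?g c) \<ge> (int n - 2) * (int n + 4) + (int n)\<^sup>2 + (int n + 2)"
    using False by simp
  then show ?thesis
    using False by (simp add: algebra_simps power2_eq_square)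
qed

end

theorem theorem4:
  fixes n :: nat and L :: "nat \<Rightarrow> nat \<Rightarrow> nat"
  assumes "n \<ge> 1" and "latin_square n L"
  shows "int (card (cuboctahedra n L)) \<ge> 3 * int n ^ 4 + int n ^ 3 - 9 * int n ^ 2 + 6 * int n"
proof -
  let ?r = "2 * (int n)\<^sup>2 + 3 * int n - 6"
  have "(\<Sum>b<n. if a = b then int n ^ 3 else ?r) = int n ^ 3 + (int n - 1) * ?r"
    if "a < n" for a
  proof -
    \<comment> \<open>Every \<open>b\<close> contributes \<open>?r\<close>, and the single index
      \<open>b = a\<close> adds a correction.\<close>
    have "(\<Sum>b<n. if a = b then int n ^ 3 else ?r) =
        (\<Sum>b<n. (if a = b then int n ^ 3 - ?r else 0) + ?r)"
      by (intro sum.cong) auto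
    also have "\<dots> = int n ^ 3 - ?r + int n * ?r"
      using that by (simp add: sum.distrib)
    finally show ?thesis
      by (simp add: algebra_simps)
  qed
  then have "(\<Sum>a<n. \<Sum>b<n. if a = b then int n ^ 3 else ?r) =
      int n * (int n ^ 3 + (int n - 1) * ?r)"
    by simp
  also have "\<dots> = 3 * int n ^ 4 + int n ^ 3 - 9 * int n ^ 2 + 6 * int n"
    by (simp add: algebra_simps power2_eq_square power3_eq_cube power4_eq_xxxx)
  finally have "3 * int n ^ 4 + int n ^ 3 - 9 * int n ^ 2 + 6 * int n =
      (\<Sum>a<n. \<Sum>b<n. if a = b then int n ^ 3 else ?r)" ..
  also have "\<dots> \<le> (\<Sum>a<n. \<Sum>b<n. \<Sum>c<n. \<Sum>d<n. (int (card (matches n L a b c d)))\<^sup>2)"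
    using assms(2) by (intro sum_mono sum_squares_matches_two_rows) auto
  also have "\<dots> = int (card (cuboctahedra n L))"
    by (simp add: card_cuboctahedra)
  finally show ?thesis .
qed

end
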